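(* Let $(X,+)$ be a magma with an additive identity $0$. Let $\Sigma$ be a summation system on $X$ such that for all $a,b\in X$, $$\Sigma(a+b)_{i\in\mathbb N}=a+\Sigma(b+a)_{i\in\mathbb N}$$ holds whenever all sums involved are defined (here $(a+b)_{i\in\mathbb N}$ and $(b+a)_{i\in\mathbb N}$ are constant families). If the constant family $(0)_{i\in\mathbb N}$ is summable and sums to $0$, then the only element of $X$ with an additive inverse is $0$.
   Context: $\mathbb N=\{0,1,2,\dots\}$. A magma is a set with a binary operation; an additive identity is two-sided, and an additive inverse of $a$ is an element $b$ with $a+b=b+a=0$. A summation system on a set $X$ is a partial function $\Sigma\colon\bigcup_I X^I\to X$, the union running over all sets $I$; a family is summable if it lies in $\mathrm{dom}(\Sigma)$. *)

theory Defs imports Main begin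

definition magma :: "'a set \<Rightarrow> ('a \<Rightarrow> 'a \<Rightarrow> 'a) \<Rightarrow> bool" where
  "magma X add \<longleftrightarrow> (\<forall>a\<in>X. \<forall>b\<in>X. add a b \<in> X)"

definition additive_identity :: "'a set \<Rightarrow> ('a \<Rightarrow> 'a \<Rightarrow> 'a) \<Rightarrow> 'a \<Rightarrow> bool" where
  "additive_identity X add e \<longleftrightarrow> e \<in> X \<and> (\<forall>a\<in>X. add e a = a \<and> add a e = a)"

definition has_additive_inverse ::
    "'a set \<Rightarrow> ('a \<Rightarrow> 'a \<Rightarrow> 'a) \<Rightarrow> 'a \<Rightarrow> 'a \<Rightarrow> bool" where
  "has_additive_inverse X add e a \<longleftrightarrow> (\<exists>b\<in>X. add a b = e \<and> add b a = e)"

text \<open>A family \<open>(x\<^sub>i)\<close>, \<open>i \<in> I\<close>, is the partial map with domain \<open>I\<close> sending \<open>i\<close> to \<open>x\<^sub>i\<close>.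
  The families over all sets \<open>I\<close> form a proper class, so index sets range over all subsets
  of a type \<open>'i\<close>, which is left arbitrary. The index set of natural numbers is then the
  range of an injection \<open>nat \<Rightarrow> 'i\<close>.\<close>

type_synonym ('i, 'a) family = "'i \<rightharpoonup> 'a"

definition families :: "'a set \<Rightarrow> ('i, 'a) family set" where
  "families X = (\<Union>I. {x. dom x = I \<and> ran x \<subseteq> X})"

definition summation_system :: "'a set \<Rightarrow> (('i, 'a) family \<rightharpoonup> 'a) \<Rightarrow> bool" where
  "summation_system X \<Sigma> \<longleftrightarrow> dom \<Sigma> \<subseteq> families X \<and> ran \<Sigma> \<subseteq> X"

definition summable_family :: "(('i, 'a) family \<rightharpoonup> 'a) \<Rightarrow> ('i, 'a) family \<Rightarrow> bool" where
  "summable_family \<Sigma> x \<longleftrightarrow> x \<in> dom \<Sigma>"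

text \<open>The value is meaningful only for summable families.\<close>

definition sum_of :: "(('i, 'a) family \<rightharpoonup> 'a) \<Rightarrow> ('i, 'a) family \<Rightarrow> 'a" where
  "sum_of \<Sigma> x = the (\<Sigma> x)"

definition const_family :: "'i set \<Rightarrow> 'a \<Rightarrow> ('i, 'a) family" where
  "const_family I a = (\<lambda>i. if i \<in> I then Some a else None)"

end

theory Submission imports Defs begin

text \<open>This is an Eilenberg swindle in miniature. If \<open>b\<close> is a two-sided inverse of
  \<open>a\<close>, then \<open>a \<oplus> b\<close> and \<open>b \<oplus> a\<close> are both
  \<open>zero\<close>, so the two constant families in the shift law are the same zero family. That
  family is summable with sum \<open>zero\<close>, and the law collapses to
  \<open>zero = a \<oplus> zero = a\<close>.\<close>

theorem theorem4p15:
  fixes X :: "'a set"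
    and add :: "'a \<Rightarrow> 'a \<Rightarrow> 'a"  (infixl "\<oplus>" 65)
    and zero :: 'a
    and \<Sigma> :: "('i, 'a) family \<rightharpoonup> 'a"
    and \<iota> :: "nat \<Rightarrow> 'i"
  defines "N \<equiv> range \<iota>"
  assumes "magma X (\<oplus>)"
    and "additive_identity X (\<oplus>) zero"
    and "summation_system X \<Sigma>"
    and "inj \<iota>"
    and "\<And>a b. a \<in> X \<Longrightarrow> b \<in> X \<Longrightarrow>
           summable_family \<Sigma> (const_family N (a \<oplus> b)) \<Longrightarrow>
           summable_family \<Sigma> (const_family N (b \<oplus> a)) \<Longrightarrow>
           sum_of \<Sigma> (const_family N (a \<oplus> b)) = a \<oplus> sum_of \<Sigma> (const_family N (b \<oplus> a))"
    and "summable_family \<Sigma> (const_family N zero)"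
    and "sum_of \<Sigma> (const_family N zero) = zero"
  shows "{a \<in> X. has_additive_inverse X (\<oplus>) zero a} = {zero}"
proof -
  have zero_mem: "zero \<in> X" and id: "\<And>a. a \<in> X \<Longrightarrow> a \<oplus> zero = a"
    using assms(3) unfolding additive_identity_def by auto
  have "a = zero" if a: "a \<in> X" and inv: "has_additive_inverse X (\<oplus>) zero a" for a
  proof -
    obtain b where b: "b \<in> X" "a \<oplus> b = zero" "b \<oplus> a = zero"
      using inv unfolding has_additive_inverse_def by blast
    \<comment> \<open>The shift law is applied to \<open>a\<close> and its inverse \<open>b\<close>:
      \<open>a \<oplus> b = zero\<close> rewrites the sum on the left,
      \<open>b \<oplus> a = zero\<close> the one on the right, and both summability premises become
      that of the zero family.\<close>
    have "zero = a \<oplus> zero"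
      using assms(6)[OF a b(1)] assms(7,8) b(2,3) by simp
    then show ?thesis using id[OF a] by simp
  qed
  \<comment> \<open>For the reverse inclusion, \<open>zero\<close> serves as its own
    inverse.\<close>
  moreover have "has_additive_inverse X (\<oplus>) zero zero"
    unfolding has_additive_inverse_def using zero_mem id by blast
  ultimately show ?thesis using zero_mem by blast
qed

end
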